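(* A strategy profile $(\Gamma_1,\dots,\Gamma_K)$ is a Nash equilibrium if $K$ is large and at each time slot there are $\tau_iK$ users sensing channel $i$ (for each $i=1,\dots,N$), where $$\tau_i=\frac{\theta_i}{\sum_{l=1}^N\theta_l}$$ and the numbers $\tau_iK$ are integers. At this equilibrium, each user has probability $\frac{1}{K}\sum_{l=1}^N\theta_l$ of transmitting at each time slot.
   Context: There are $N$ channels, $K$ users and $T$ time slots; $B$ is the number of bits that can be sent over a free channel in one slot. In each slot, channel $i$ is free with probability $\theta_i$, independently over channels and slots; $\theta=(\theta_1,\dots,\theta_N)$ is known to all users. In each slot the users, in a distributed manner, each choose one channel to sense. If channel $i$ is free, exactly one of the users sensing channel $i$ in that slot, each being equally likely, gains access to it and transmits $B$ bits; if it is not free, nobody transmits on it. The channel selection problem is modeled as a non-cooperative game: the players are the $K$ users; the strategy $\Gamma_k$ of user $k$ is its sensing rule, which determines the channel it senses in each slot $j=1,\dots,T$; the payoff of user $k$ is its average throughput, i.e. the expected total number of bits it transmits over the $T$ slots. A profile is a Nash equilibrium if no user can increase its payoff by unilaterally changing its own strategy. *)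

theory Defs
  imports "HOL-Probability.Probability"
begin

text \<open>
  Users are \<open>0, \<dots>, K - 1\<close>, channels are \<open>0, \<dots>, N - 1\<close> and slots are \<open>0, \<dots>, T - 1\<close>.
  After each slot a user knows the channel it sensed, whether that channel was free, and whether
  it was the one that gained access to it.
\<close>

datatype observation = Observation (sensed_channel: nat) (found_free: bool) (transmitted: bool)

text \<open>
  A sensing rule yields the channel to sense in the next slot from the user's own past
  observations, so the length of the list is the slot index. It may randomize privately.
\<close>

type_synonym strategy = "observation list \<Rightarrow> nat pmf"

definition is_strategy :: "nat \<Rightarrow> strategy \<Rightarrow> bool" where
  "is_strategy N \<sigma> \<longleftrightarrow> (\<forall>os. set_pmf (\<sigma> os) \<subseteq> {..<N})"

definition sensing_pmf ::
  "nat \<Rightarrow> (nat \<Rightarrow> strategy) \<Rightarrow> (nat \<Rightarrow> observation list) \<Rightarrow> (nat \<Rightarrow> nat) pmf" where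
  "sensing_pmf K \<Gamma> h = Pi_pmf {..<K} 0 (\<lambda>k. \<Gamma> k (h k))"

definition sensors :: "nat \<Rightarrow> (nat \<Rightarrow> nat) \<Rightarrow> nat \<Rightarrow> nat set" where
  "sensors K a i = {k. k < K \<and> a k = i}"

text \<open>
  The winner of the contention on a channel is drawn in every slot, but it only takes effect (and is
  only observed) if the channel is free. Nobody wins a channel that nobody senses.
\<close>

definition winner_pmf :: "nat \<Rightarrow> (nat \<Rightarrow> nat) \<Rightarrow> nat \<Rightarrow> nat option pmf" where
  "winner_pmf K a i =
     (if sensors K a i = {} then return_pmf None
      else map_pmf Some (pmf_of_set (sensors K a i)))"

definition slot_pmf ::
  "nat \<Rightarrow> (nat \<Rightarrow> real) \<Rightarrow> nat \<Rightarrow> (nat \<Rightarrow> strategy) \<Rightarrow> (nat \<Rightarrow> observation list)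
     \<Rightarrow> (nat \<Rightarrow> observation list) pmf" where
  "slot_pmf N \<theta> K \<Gamma> h =
     do {
       a \<leftarrow> sensing_pmf K \<Gamma> h;
       free \<leftarrow> Pi_pmf {..<N} False (\<lambda>i. bernoulli_pmf (\<theta> i));
       winner \<leftarrow> Pi_pmf {..<N} None (\<lambda>i. winner_pmf K a i);
       return_pmf (\<lambda>k. h k @
         [Observation (a k) (free (a k)) (free (a k) \<and> winner (a k) = Some k)])
     }"

primrec play_pmf ::
  "nat \<Rightarrow> (nat \<Rightarrow> real) \<Rightarrow> nat \<Rightarrow> (nat \<Rightarrow> strategy) \<Rightarrow> nat \<Rightarrow> (nat \<Rightarrow> observation list) pmf" where
  "play_pmf N \<theta> K \<Gamma> 0 = return_pmf (\<lambda>_. [])"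
| "play_pmf N \<theta> K \<Gamma> (Suc t) = bind_pmf (play_pmf N \<theta> K \<Gamma> t) (slot_pmf N \<theta> K \<Gamma>)"

definition payoff ::
  "nat \<Rightarrow> (nat \<Rightarrow> real) \<Rightarrow> nat \<Rightarrow> nat \<Rightarrow> nat \<Rightarrow> (nat \<Rightarrow> strategy) \<Rightarrow> nat \<Rightarrow> real" where
  "payoff N \<theta> K T B \<Gamma> k =
     measure_pmf.expectation (play_pmf N \<theta> K \<Gamma> T)
       (\<lambda>h. \<Sum>j<T. if transmitted (h k ! j) then real B else 0)"

definition transmission_prob ::
  "nat \<Rightarrow> (nat \<Rightarrow> real) \<Rightarrow> nat \<Rightarrow> nat \<Rightarrow> (nat \<Rightarrow> strategy) \<Rightarrow> nat \<Rightarrow> nat \<Rightarrow> real" where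
  "transmission_prob N \<theta> K T \<Gamma> k j =
     measure_pmf.prob (play_pmf N \<theta> K \<Gamma> T) {h. transmitted (h k ! j)}"

definition nash_equilibrium ::
  "nat \<Rightarrow> (nat \<Rightarrow> real) \<Rightarrow> nat \<Rightarrow> nat \<Rightarrow> nat \<Rightarrow> (nat \<Rightarrow> strategy) \<Rightarrow> bool" where
  "nash_equilibrium N \<theta> K T B \<Gamma> \<longleftrightarrow>
     (\<forall>k<K. is_strategy N (\<Gamma> k)) \<and>
     (\<forall>k<K. \<forall>\<sigma>. is_strategy N \<sigma> \<longrightarrow>
        payoff N \<theta> K T B (\<Gamma>(k := \<sigma>)) k \<le> payoff N \<theta> K T B \<Gamma> k)"

definition \<tau> :: "nat \<Rightarrow> (nat \<Rightarrow> real) \<Rightarrow> nat \<Rightarrow> real" where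
  "\<tau> N \<theta> i = \<theta> i / (\<Sum>l<N. \<theta> l)"

text \<open>
  The allocation is required whatever the users have observed, not merely almost surely along the
  play of the profile. Under the latter, other users could react to a deviation (which changes who
  gains access) in the deviator's favour: take two channels that are always free and \<open>m \<ge> 2\<close>
  users on each; after the first slot each channel's winner stays for good and its losers move to
  the other channel for good. Along the play there are always \<open>m\<close> users per channel, but for
  \<open>T > m\<close> a user of one channel gains by switching to the other one in all slots.
\<close>

definition proportional_allocation ::
  "nat \<Rightarrow> (nat \<Rightarrow> real) \<Rightarrow> nat \<Rightarrow> nat \<Rightarrow> (nat \<Rightarrow> strategy) \<Rightarrow> bool" where
  "proportional_allocation N \<theta> K T \<Gamma> \<longleftrightarrow>
     (\<forall>j<T. \<forall>h. (\<forall>k<K. length (h k) = j) \<longrightarrow>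
        (\<forall>a\<in>set_pmf (sensing_pmf K \<Gamma> h). \<forall>i<N. real (card (sensors K a i)) = \<tau> N \<theta> i * real K))"

end

theory Submission
  imports Defs
begin

text \<open>
  In every slot, whatever has been observed so far, a user sensing channel \<open>i\<close> together with
  \<open>n - 1\<close> others transmits with probability \<open>\<theta>\<^sub>i / n\<close>. In the proportional allocation this is
  \<open>(\<Sum>l. \<theta>\<^sub>l) / K\<close> on every channel, whereas a deviator moving to channel \<open>i\<close> meets
  \<open>\<tau>\<^sub>i K\<close> other users there and gets \<open>\<theta>\<^sub>i / (\<tau>\<^sub>i K + 1)\<close>, which is no more. Since the allocation
  persists whatever the users observe, a deviation cannot improve later slots either.
\<close>

text \<open>A mean of values at most \<open>c\<close> is at most \<open>c\<close>. Only the support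
  of \<open>M\<close> counts, so facts about reachable histories and possible choices can be
  used.\<close>

lemma pmf_bind_le:
  assumes "\<And>x. x \<in> set_pmf M \<Longrightarrow> pmf (f x) i \<le> c"
  shows "pmf (bind_pmf M f) i \<le> c"
  unfolding pmf_bind using assms
  by (intro measure_pmf.integral_le_const measure_pmf.integrable_const_bound[where B = 1])
     (auto simp: AE_measure_pmf_iff pmf_le_1)

lemma pmf_bind_const:
  assumes "\<And>x. x \<in> set_pmf M \<Longrightarrow> pmf (f x) i = c"
  shows "pmf (bind_pmf M f) i = c"
proof -
  have "pmf (bind_pmf M f) i = measure_pmf.expectation M (\<lambda>_. c)"
    unfolding pmf_bind using assms by (intro integral_cong_AE) (auto simp: AE_measure_pmf_iff)
  then show ?thesis by simp
qed

text \<open>Recasts an event as a boolean-valued distribution, so that its probability can be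
  computed by monadic rewriting.\<close>

lemma prob_eq_pmf_map_True: "measure_pmf.prob M {x. P x} = pmf (map_pmf P M) True"
  by (simp add: pmf_map vimage_def)

lemma finite_sensors: "finite (sensors K a i)"
  by (simp add: sensors_def)

lemma pmf_winner_pmf:
  assumes "k < K"
  shows "pmf (winner_pmf K a (a k)) (Some k) = 1 / real (card (sensors K a (a k)))"
proof -
  have k: "k \<in> sensors K a (a k)" using assms by (simp add: sensors_def)
  then have "pmf (map_pmf Some (pmf_of_set (sensors K a (a k)))) (Some k)
      = pmf (pmf_of_set (sensors K a (a k))) k"
    by (intro pmf_map_inj') simp
  moreover have "sensors K a (a k) \<noteq> {}" using k by blast
  ultimately show ?thesis
    using k by (simp add: winner_pmf_def finite_sensors)
qed

text \<open>Availability and contention are drawn independently, so their probabilities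
  \<open>p\<close> and \<open>1 / card\<close> multiply.\<close>

lemma pmf_free_and_winner:
  assumes "k < K" "0 \<le> p" "p \<le> 1"
  shows "pmf (bind_pmf (bernoulli_pmf p)
           (\<lambda>free. map_pmf (\<lambda>w. free \<and> w = Some k) (winner_pmf K a (a k)))) True
         = p / real (card (sensors K a (a k)))"
proof -
  have "(\<lambda>w. w = Some k) -` {True} = {Some k}" by auto
  then have "pmf (map_pmf (\<lambda>w. w = Some k) (winner_pmf K a (a k))) True
      = 1 / real (card (sensors K a (a k)))"
    using pmf_winner_pmf[OF assms(1)] by (simp add: pmf_map measure_pmf_single)
  then show ?thesis
    using assms by (simp add: pmf_bind map_pmf_const)
qed

text \<open>Once \<open>a\<close> is drawn, the outcome for user \<open>k\<close> depends only on
  the coordinate \<open>a k\<close> of the two product distributions, so each collapses to its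
  marginal. A coordinate outside \<open>{..<N}\<close> would carry the default value
  instead.\<close>

lemma map_transmitted_slot_pmf:
  assumes "length (h k) = t" "\<And>a. a \<in> set_pmf (sensing_pmf K \<Gamma> h) \<Longrightarrow> a k < N"
  shows "map_pmf (\<lambda>h. transmitted (h k ! t)) (slot_pmf N \<theta> K \<Gamma> h) =
     bind_pmf (sensing_pmf K \<Gamma> h) (\<lambda>a. bind_pmf (bernoulli_pmf (\<theta> (a k)))
       (\<lambda>free. map_pmf (\<lambda>w. free \<and> w = Some k) (winner_pmf K a (a k))))"
proof -
  \<comment> \<open>Oriented from factor to marginal: the right-hand side of the goal is expanded to
    the product distributions on the left.\<close>
  have comp: "p i = map_pmf (\<lambda>f. f i) (Pi_pmf {..<N} d p)" if "i < N"
    for i and d :: 'b and p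
    using that by (simp add: Pi_pmf_component)
  show ?thesis
    unfolding slot_pmf_def map_bind_pmf
  proof (intro bind_pmf_cong refl)
    fix a assume "a \<in> set_pmf (sensing_pmf K \<Gamma> h)"
    then have "a k < N" by (rule assms(2))
    then show "bind_pmf (Pi_pmf {..<N} False (\<lambda>i. bernoulli_pmf (\<theta> i)))
      (\<lambda>free. bind_pmf (Pi_pmf {..<N} None (winner_pmf K a))
        (\<lambda>winner. map_pmf (\<lambda>h. transmitted (h k ! t)) (return_pmf (\<lambda>k. h k @
          [Observation (a k) (free (a k)) (free (a k) \<and> winner (a k) = Some k)])))) =
      bind_pmf (bernoulli_pmf (\<theta> (a k)))
        (\<lambda>free. map_pmf (\<lambda>w. free \<and> w = Some k) (winner_pmf K a (a k)))"
      using assms(1)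
      by (simp add: comp[of "a k" "\<lambda>i. bernoulli_pmf (\<theta> i)" False]
            comp[of "a k" "winner_pmf K a" None] bind_map_pmf nth_append)
         (simp add: map_pmf_def bind_assoc_pmf bind_return_pmf)
  qed
qed

lemma length_play_pmf:
  "h \<in> set_pmf (play_pmf N \<theta> K \<Gamma> t) \<Longrightarrow> length (h k) = t"
  by (induction t arbitrary: h) (auto simp: slot_pmf_def)

text \<open>Later slots only append to the histories, so entry \<open>j\<close> keeps its
  distribution and slot \<open>j\<close> may be treated as the last one.\<close>

lemma transmission_prob_Suc:
  assumes "j < T"
  shows "transmission_prob N \<theta> K T \<Gamma> k j = transmission_prob N \<theta> K (Suc j) \<Gamma> k j"
  using assms
proof (induction T)
  case (Suc T)
  show ?case
  proof (cases "j = T")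
    case False
    with Suc.prems have j: "j < T" by simp
    have "map_pmf (\<lambda>h. transmitted (h k ! j)) (slot_pmf N \<theta> K \<Gamma> h)
        = return_pmf (transmitted (h k ! j))" if "h \<in> set_pmf (play_pmf N \<theta> K \<Gamma> T)" for h
      using length_play_pmf[OF that, of k] j
      by (simp add: slot_pmf_def map_bind_pmf nth_append)
    then have "map_pmf (\<lambda>h. transmitted (h k ! j)) (play_pmf N \<theta> K \<Gamma> (Suc T))
        = map_pmf (\<lambda>h. transmitted (h k ! j)) (play_pmf N \<theta> K \<Gamma> T)"
      by (simp add: map_bind_pmf map_pmf_def[of _ "play_pmf N \<theta> K \<Gamma> T"] cong: bind_pmf_cong)
    then show ?thesis
      using Suc.IH[OF j] by (simp add: transmission_prob_def prob_eq_pmf_map_True)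
  qed simp
qed simp

text \<open>Linearity of expectation: slots can be compared one at a time although histories make
  them dependent.\<close>

lemma payoff_eq_sum_transmission_prob:
  "payoff N \<theta> K T B \<Gamma> k = (\<Sum>j<T. real B * transmission_prob N \<theta> K T \<Gamma> k j)"
proof -
  let ?M = "measure_pmf (play_pmf N \<theta> K \<Gamma> T)"
  have ind: "(if transmitted (h k ! j) then real B else 0)
      = real B * indicator {h. transmitted (h k ! j)} h" for h :: "nat \<Rightarrow> observation list" and j
    by simp
  show ?thesis
    unfolding payoff_def transmission_prob_def ind
    by (subst Bochner_Integration.integral_sum)
       (auto intro!: measure_pmf.integrable_const_bound[where B = 1])
qed

lemma sensing_pmf_less:
  assumes "is_strategy N (\<Gamma> k)" "k < K" "a \<in> set_pmf (sensing_pmf K \<Gamma> h)"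
  shows "a k < N"
  using assms by (auto simp: sensing_pmf_def set_Pi_pmf PiE_dflt_def is_strategy_def)

text \<open>Given the history and the joint choice, user \<open>k\<close> transmits with probability
  equal to its share \<open>\<theta> (a k) / card\<close>; a bound or common value of the shares
  passes to the average. Histories are restricted only by their length, to match
  \<open>proportional_allocation\<close>.\<close>

lemma
  assumes \<theta>: "\<And>i. i < N \<Longrightarrow> 0 \<le> \<theta> i \<and> \<theta> i \<le> 1"
    and strategy: "is_strategy N (\<Gamma> k)" and k: "k < K" and j: "j < T"
  shows transmission_prob_le:
      "(\<And>h a. (\<And>k. length (h k) = j) \<Longrightarrow> a \<in> set_pmf (sensing_pmf K \<Gamma> h) \<Longrightarrow>
          \<theta> (a k) / real (card (sensors K a (a k))) \<le> c) \<Longrightarrow>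
        transmission_prob N \<theta> K T \<Gamma> k j \<le> c"
    and transmission_prob_eq:
      "(\<And>h a. (\<And>k. length (h k) = j) \<Longrightarrow> a \<in> set_pmf (sensing_pmf K \<Gamma> h) \<Longrightarrow>
          \<theta> (a k) / real (card (sensors K a (a k))) = c) \<Longrightarrow>
        transmission_prob N \<theta> K T \<Gamma> k j = c"
proof -
  note less = sensing_pmf_less[of N \<Gamma>, OF strategy k]
  have "transmission_prob N \<theta> K T \<Gamma> k j =
    pmf (bind_pmf (play_pmf N \<theta> K \<Gamma> j) (\<lambda>h. map_pmf (\<lambda>h. transmitted (h k ! j)) (slot_pmf N \<theta> K \<Gamma> h))) True"
    using transmission_prob_Suc[OF j]
    by (simp add: transmission_prob_def prob_eq_pmf_map_True map_bind_pmf)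
  also have "\<dots> = pmf (bind_pmf (play_pmf N \<theta> K \<Gamma> j) (\<lambda>h. bind_pmf (sensing_pmf K \<Gamma> h)
      (\<lambda>a. bind_pmf (bernoulli_pmf (\<theta> (a k)))
        (\<lambda>free. map_pmf (\<lambda>w. free \<and> w = Some k) (winner_pmf K a (a k)))))) True"
    using less by (intro arg_cong2[of _ _ _ _ pmf] bind_pmf_cong refl map_transmitted_slot_pmf)
      (auto dest: length_play_pmf)
  finally have eq: "transmission_prob N \<theta> K T \<Gamma> k j = \<dots>" .
  have slot: "pmf (bind_pmf (bernoulli_pmf (\<theta> (a k)))
        (\<lambda>free. map_pmf (\<lambda>w. free \<and> w = Some k) (winner_pmf K a (a k)))) True
      = \<theta> (a k) / real (card (sensors K a (a k)))" if "a \<in> set_pmf (sensing_pmf K \<Gamma> h)" for h a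
    using \<theta> less[OF that] k by (intro pmf_free_and_winner) auto
  show "transmission_prob N \<theta> K T \<Gamma> k j \<le> c"
    if "\<And>h a. (\<And>k. length (h k) = j) \<Longrightarrow> a \<in> set_pmf (sensing_pmf K \<Gamma> h) \<Longrightarrow>
          \<theta> (a k) / real (card (sensors K a (a k))) \<le> c"
    unfolding eq by (rule pmf_bind_le, rule pmf_bind_le)
      (auto simp: slot intro: that dest: length_play_pmf)
  show "transmission_prob N \<theta> K T \<Gamma> k j = c"
    if "\<And>h a. (\<And>k. length (h k) = j) \<Longrightarrow> a \<in> set_pmf (sensing_pmf K \<Gamma> h) \<Longrightarrow>
          \<theta> (a k) / real (card (sensors K a (a k))) = c"
    unfolding eq by (rule pmf_bind_const, rule pmf_bind_const)
      (auto simp: slot intro: that dest: length_play_pmf)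
qed

lemma card_sensors_pos:
  assumes "k < K"
  shows "0 < card (sensors K a (a k))"
  using assms by (auto simp: card_gt_0_iff finite_sensors) (auto simp: sensors_def)

text \<open>Here \<open>a\<close> is the choice after a deviation and \<open>c\<close> the channel
  that user \<open>k\<close> would otherwise sense: \<open>k\<close> is the one extra contender on
  its new channel.\<close>

lemma card_sensors_deviation:
  assumes "k < K" "a k \<noteq> c"
  shows "card (sensors K a (a k)) = Suc (card (sensors K (a(k := c)) (a k)))"
proof -
  have "sensors K a (a k) = insert k (sensors K (a(k := c)) (a k))"
    using assms by (auto simp: sensors_def)
  moreover have "k \<notin> sensors K (a(k := c)) (a k)"
    using assms by (auto simp: sensors_def)
  ultimately show ?thesis by (simp add: finite_sensors)
qed

text \<open>User \<open>k\<close> itself makes the count positive, which forces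
  \<open>\<theta> (a k)\<close> to be nonzero, so it cancels.\<close>

lemma proportional_share:
  assumes "proportional_allocation N \<theta> K T \<Gamma>" "(\<Sum>l<N. \<theta> l) > 0"
    and "j < T" "\<And>k. length (h k) = j" "a \<in> set_pmf (sensing_pmf K \<Gamma> h)" "k < K" "a k < N"
  shows "\<theta> (a k) / real (card (sensors K a (a k))) = 1 / real K * (\<Sum>l<N. \<theta> l)"
proof -
  have "real (card (sensors K a (a k))) = \<tau> N \<theta> (a k) * real K"
    using assms unfolding proportional_allocation_def by blast
  moreover have "0 < card (sensors K a (a k))"
    using assms(6) by (rule card_sensors_pos)
  ultimately show ?thesis
    using assms(2,6) by (auto simp: \<tau>_def field_simps)
qed

lemma deviation_share_le:
  assumes alloc: "proportional_allocation N \<theta> K T \<Gamma>" and S: "(\<Sum>l<N. \<theta> l) > 0"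
    and strategy: "is_strategy N (\<Gamma> k)"
    and j: "j < T" and len: "\<And>k. length (h k) = j"
    and a: "a \<in> set_pmf (sensing_pmf K (\<Gamma>(k := \<sigma>)) h)" and k: "k < K"
    and aN: "a k < N" and nonneg: "0 \<le> \<theta> (a k)"
  shows "\<theta> (a k) / real (card (sensors K a (a k))) \<le> 1 / real K * (\<Sum>l<N. \<theta> l)"
proof -
  \<comment> \<open>Any channel the original rule could pick after \<open>h\<close> will do. Users
    choose independently, so replacing one coordinate of \<open>a\<close> by \<open>c\<close> gives
    a possible choice of \<open>\<Gamma>\<close>, to which the allocation applies even if only the
    deviation leads to \<open>h\<close>.\<close>
  obtain c where c: "c \<in> set_pmf (\<Gamma> k (h k))"
    using set_pmf_not_empty[of "\<Gamma> k (h k)"] by blast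
  let ?b = "a(k := c)"
  have b: "?b \<in> set_pmf (sensing_pmf K \<Gamma> h)"
    using a c k by (auto simp: sensing_pmf_def set_Pi_pmf PiE_dflt_def)
  show ?thesis
  proof (cases "a k = c")
    case True
    then have "?b = a" by auto
    with b have "a \<in> set_pmf (sensing_pmf K \<Gamma> h)" by simp
    then show ?thesis
      using proportional_share[of N \<theta> K T \<Gamma> j h a k] alloc S j len k aN by simp
  next
    case False
    have "real (card (sensors K ?b (a k))) = \<tau> N \<theta> (a k) * real K"
      using alloc j len b aN unfolding proportional_allocation_def by blast
    then have "real (card (sensors K a (a k))) = \<tau> N \<theta> (a k) * real K + 1"
      using card_sensors_deviation[of k K a c, OF k False] by simp
    moreover have "0 \<le> \<tau> N \<theta> (a k) * real K"
      using nonneg S by (simp add: \<tau>_def)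
    \<comment> \<open>With \<open>x\<close> the prescribed number of users and \<open>v\<close> the
      equilibrium share, this reads \<open>\<theta> (a k) = x * v\<close>; the claim becomes
      \<open>x * v / (x + 1) \<le> v\<close>.\<close>
    moreover have "\<theta> (a k) = \<tau> N \<theta> (a k) * real K * (1 / real K * (\<Sum>l<N. \<theta> l))"
      using S k by (simp add: \<tau>_def)
    moreover have "0 \<le> 1 / real K * (\<Sum>l<N. \<theta> l)" using S by simp
    ultimately show ?thesis
      by (smt (verit) divide_le_eq mult.commute mult_right_mono)
  qed
qed

theorem lemma8:
  fixes N :: nat and \<theta> :: "nat \<Rightarrow> real"
  assumes "\<And>i. i < N \<Longrightarrow> 0 \<le> \<theta> i \<and> \<theta> i \<le> 1"
    and "(\<Sum>l<N. \<theta> l) > 0"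
  shows "\<exists>K0. \<forall>K\<ge>K0. \<forall>(T::nat) (B::nat) (\<Gamma> :: nat \<Rightarrow> strategy).
           (\<forall>k<K. is_strategy N (\<Gamma> k)) \<and>
           (\<forall>i<N. \<tau> N \<theta> i * real K \<in> \<int>) \<and>
           proportional_allocation N \<theta> K T \<Gamma> \<longrightarrow>
             nash_equilibrium N \<theta> K T B \<Gamma> \<and>
             (\<forall>k<K. \<forall>j<T. transmission_prob N \<theta> K T \<Gamma> k j = 1 / real K * (\<Sum>l<N. \<theta> l))"
\<comment> \<open>The witness is 0 because the comparison of shares is an exact inequality, not an
  asymptotic one.\<close>
proof (intro exI[of _ 0] allI impI, elim conjE)
  fix K T B :: nat and \<Gamma> :: "nat \<Rightarrow> strategy"
  assume strategies: "\<forall>k<K. is_strategy N (\<Gamma> k)"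
    and alloc: "proportional_allocation N \<theta> K T \<Gamma>"
  have eq: "transmission_prob N \<theta> K T \<Gamma> k j = 1 / real K * (\<Sum>l<N. \<theta> l)"
    if k: "k < K" and j: "j < T" for k j
  proof (rule transmission_prob_eq[OF assms(1) _ k j])
    show "is_strategy N (\<Gamma> k)" using strategies k by blast
    then show "\<theta> (a k) / real (card (sensors K a (a k))) = 1 / real K * (\<Sum>l<N. \<theta> l)"
      if "\<And>k. length (h k) = j" "a \<in> set_pmf (sensing_pmf K \<Gamma> h)" for h a
      using that by (intro proportional_share[OF alloc assms(2) j _ _ k] sensing_pmf_less[OF _ k])
  qed
  have le: "transmission_prob N \<theta> K T (\<Gamma>(k := \<sigma>)) k j \<le> 1 / real K * (\<Sum>l<N. \<theta> l)"
    if k: "k < K" and j: "j < T" and \<sigma>: "is_strategy N \<sigma>" for k j \<sigma>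
  proof (rule transmission_prob_le[OF assms(1) _ k j])
    show dev: "is_strategy N ((\<Gamma>(k := \<sigma>)) k)" using \<sigma> by simp
    show "\<theta> (a k) / real (card (sensors K a (a k))) \<le> 1 / real K * (\<Sum>l<N. \<theta> l)"
      if len: "\<And>k. length (h k) = j" and a: "a \<in> set_pmf (sensing_pmf K (\<Gamma>(k := \<sigma>)) h)" for h a
    proof -
      have "a k < N" by (rule sensing_pmf_less[OF dev k a])
      then show ?thesis
        using assms(1) strategies k by (intro deviation_share_le[OF alloc assms(2) _ j len a k]) auto
    qed
  qed
  \<comment> \<open>In each slot the deviator gets at most the common value attained under
    \<open>\<Gamma>\<close>; summing over slots compares the payoffs.\<close>
  have "payoff N \<theta> K T B (\<Gamma>(k := \<sigma>)) k \<le> payoff N \<theta> K T B \<Gamma> k"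
    if "k < K" "is_strategy N \<sigma>" for k \<sigma>
    unfolding payoff_eq_sum_transmission_prob using le eq that
    by (intro sum_mono mult_left_mono) auto
  then show "nash_equilibrium N \<theta> K T B \<Gamma> \<and>
      (\<forall>k<K. \<forall>j<T. transmission_prob N \<theta> K T \<Gamma> k j = 1 / real K * (\<Sum>l<N. \<theta> l))"
    using strategies eq by (simp add: nash_equilibrium_def)
qed

end
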